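(* For all positive integers $d\le n$, \begin{equation*} T(2n,d)= \sum_{j=0}^{\lfloor \frac{d-1}2\rfloor} \frac{(-1)^j\pi^{2j}}{2^{2d-2} (2j)!\, d} \binom{2d-2j-2}{d-1} t(2n-2j), \end{equation*} where $t(2m)=\sum_{k\ge1}(2k-1)^{-2m}=2^{-2m}(2^{2m}-1)\zeta(2m)$ for $m\ge1$. Equivalently, \begin{equation*} T(2n,d)=\binom{2d-2}{d-1}\frac{t(2n)}{2^{2d-2}d} -\sum_{j=1}^{\lfloor \frac{d-1}2\rfloor} \binom{2d-2j-2}{d-1} \frac{t(2j)\,t(2n-2j)}{2^{2d-3}(2^{2j}-1)B_{2j}\, d} . \end{equation*}
   Context: For positive integers $s_1,\dots,s_d$ (with $s_1\ge2$), the multiple $t$-value is $t(s_1,\dots,s_d)=\sum_{n_1>\cdots>n_d\ge 1}\prod_{i=1}^d (2n_i-1)^{-s_i}$; in particular $t(2m)=\sum_{k\ge1}(2k-1)^{-2m}$. For $d\le n$ define $T(2n,d)=\sum_{j_1+\cdots+j_d=n,\ j_1,\dots,j_d\ge 1} t(2j_1,\dots,2j_d)$. The Bernoulli numbers $B_j$ are defined by $\frac{x}{e^x-1}=\sum_{j\ge0}B_j\frac{x^j}{j!}$, and $\zeta$ is the Riemann zeta function. *)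

theory Defs
  imports
    "HOL-Analysis.Analysis"
    "HOL-Computational_Algebra.Formal_Power_Series"
begin

text \<open>
  The summation indices \<open>n\<^sub>1 > \<dots> > n\<^sub>d \<ge> 1\<close> of a multiple \<open>t\<close>-value,
  as strictly decreasing lists \<open>[n\<^sub>1, \<dots>, n\<^sub>d]\<close>.
\<close>

definition decr_indices :: "nat \<Rightarrow> nat list set" where
  "decr_indices d = {ns. length ns = d \<and> sorted_wrt (>) ns \<and> (\<forall>k\<in>set ns. 1 \<le> k)}"

text \<open>
  The multiple \<open>t\<close>-value \<open>t(s\<^sub>1, \<dots>, s\<^sub>d)\<close> is \<open>mtv [s\<^sub>1, \<dots>, s\<^sub>d]\<close>. All terms are
  positive, so unordered summation agrees with any order of summation. The value is
  meaningful for positive arguments with \<open>s\<^sub>1 \<ge> 2\<close>.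
\<close>

definition mtv :: "nat list \<Rightarrow> real" where
  "mtv s = (\<Sum>\<^sub>\<infinity>ns\<in>decr_indices (length s).
     \<Prod>i<length s. 1 / (2 * real (ns ! i) - 1) ^ (s ! i))"

definition compositions :: "nat \<Rightarrow> nat \<Rightarrow> nat list set" where
  "compositions n d = {js. length js = d \<and> (\<forall>j\<in>set js. 1 \<le> j) \<and> sum_list js = n}"

lemma finite_compositions: "finite (compositions n d)"
proof (rule finite_subset)
  show "compositions n d \<subseteq> {js. set js \<subseteq> {..n} \<and> length js = d}"
    by (auto simp: compositions_def dest: member_le_sum_list)
  show "finite {js. set js \<subseteq> {..n} \<and> length js = d}"
    by (rule finite_lists_length_eq) simp
qed

text \<open>
  \<open>T_even n d\<close> is \<open>T(2n, d)\<close>: the first argument is half the weight.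
\<close>

definition T_even :: "nat \<Rightarrow> nat \<Rightarrow> real" where
  "T_even n d = (\<Sum>js\<in>compositions n d. mtv (map (\<lambda>j. 2 * j) js))"

text \<open>
  \<open>B\<^sub>j\<close> is \<open>j!\<close> times the \<open>j\<close>-th coefficient of the formal power series \<open>x / (e\<^sup>x - 1)\<close>.
  The quotient is the exact one: \<open>e\<^sup>x - 1\<close> divides \<open>x\<close> because both have order 1 at 0.
\<close>

definition bernoulli :: "nat \<Rightarrow> real" where
  "bernoulli j = fact j * fps_nth (fps_X / (fps_exp 1 - 1)) j"

text \<open>
  The Riemann zeta function as its Dirichlet series, hence only meaningful on the
  half-plane \<open>Re s > 1\<close>.
\<close>

definition zeta :: "complex \<Rightarrow> complex" where
  "zeta s = (\<Sum>k. of_nat (Suc k) powr (- s))"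

end

theory Submission
  imports
    Defs
    "HOL-Computational_Algebra.Formal_Laurent_Series"
    "HOL-Complex_Analysis.Cauchy_Integral_Formula"
begin

unbundle no vec_syntax

text \<open>
  With \<open>x k = 1 / (2 * k - 1)\<^sup>2\<close> the generating function of the \<open>T(2n, d)\<close> is
  \<open>\<Prod>k. 1 + y * x k * z / (1 - x k * z) = cos (b * sqrt (1 - y)) / cos b\<close> where
  \<open>b = pi / 2 * sqrt z\<close>. Its numerator satisfies a second order differential equation in \<open>y\<close>, so its
  coefficients \<open>F d\<close> of \<open>y ^ d\<close> satisfy a three-term recurrence in \<open>d\<close>. Hence
  \<open>F d / cos b = p d * (F 1 / cos b) + q d\<close> with polynomials \<open>p d\<close>, \<open>q d\<close> in \<open>b\<^sup>2\<close>, where \<open>p d\<close>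
  has explicit coefficients, \<open>F 1 / cos b = b / 2 * tan b\<close> generates the \<open>t(2n)\<close>, and the degree
  of \<open>q d\<close> is too small to contribute for \<open>n \<ge> d\<close>. The second form follows by expressing
  \<open>pi ^ (2 * j)\<close> through \<open>t(2j)\<close> and \<open>B\<^bsub>2j\<^esub>\<close>.
\<close>

section \<open>Finite truncations and their recursion in the largest index\<close>

definition truncated_indices :: "nat \<Rightarrow> nat \<Rightarrow> nat list set" where
  "truncated_indices N d = {ns \<in> decr_indices d. \<forall>k\<in>set ns. k \<le> N}"

text \<open>The weights \<open>x\<close> stay arbitrary while only algebra is done. The entries of
  \<open>js\<close> are halved arguments, since \<open>x k\<close> will be an inverse
  square.\<close>

definition monomial_at :: "(nat \<Rightarrow> real) \<Rightarrow> nat list \<Rightarrow> nat list \<Rightarrow> real" where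
  "monomial_at x js ns = (\<Prod>i<length js. x (ns ! i) ^ (js ! i))"

definition truncated_sum :: "(nat \<Rightarrow> real) \<Rightarrow> nat \<Rightarrow> nat list \<Rightarrow> real" where
  "truncated_sum x N js = (\<Sum>ns\<in>truncated_indices N (length js). monomial_at x js ns)"

definition truncated_T :: "(nat \<Rightarrow> real) \<Rightarrow> nat \<Rightarrow> nat \<Rightarrow> nat \<Rightarrow> real" where
  "truncated_T x N n d = (\<Sum>js\<in>compositions n d. truncated_sum x N js)"

lemma finite_truncated_indices: "finite (truncated_indices N d)"
proof (rule finite_subset)
  show "truncated_indices N d \<subseteq> {ns. set ns \<subseteq> {..N} \<and> length ns = d}"
    by (auto simp: truncated_indices_def decr_indices_def)
  show "finite {ns. set ns \<subseteq> {..N} \<and> length ns = d}"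
    by (rule finite_lists_length_eq) simp
qed

lemma truncated_indices_0_right [simp]: "truncated_indices N 0 = {[]}"
  by (auto simp: truncated_indices_def decr_indices_def)

lemma truncated_indices_0_Suc [simp]: "truncated_indices 0 (Suc d) = {}"
  by (auto simp: truncated_indices_def decr_indices_def length_Suc_conv)

text \<open>The head of a strictly decreasing list is its maximum, so the bound \<open>Suc N\<close>
  is attained at the head or not at all.\<close>

lemma truncated_indices_Suc_Suc:
  "truncated_indices (Suc N) (Suc d) =
     truncated_indices N (Suc d) \<union> Cons (Suc N) ` truncated_indices N d"
proof (intro equalityI subsetI)
  fix ns assume "ns \<in> truncated_indices (Suc N) (Suc d)"
  then obtain k ks where ks: "ns = k # ks" "length ks = d" "sorted_wrt (>) ks" "\<forall>i\<in>set ks. i < k"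
    "\<forall>i\<in>set ks. 1 \<le> i" "1 \<le> k" "k \<le> Suc N"
    by (auto simp: truncated_indices_def decr_indices_def length_Suc_conv)
  show "ns \<in> truncated_indices N (Suc d) \<union> Cons (Suc N) ` truncated_indices N d"
  proof (cases "k = Suc N")
    case True
    then have "ks \<in> truncated_indices N d"
      using ks by (auto simp: truncated_indices_def decr_indices_def)
    then show ?thesis using True ks(1) by blast
  next
    case False
    then have "ns \<in> truncated_indices N (Suc d)"
      using ks by (auto simp: truncated_indices_def decr_indices_def dest!: bspec)
    then show ?thesis by blast
  qed
qed (auto simp: truncated_indices_def decr_indices_def less_Suc_eq_le intro: le_SucI)

lemma monomial_at_Nil [simp]: "monomial_at x [] ns = 1"
  by (simp add: monomial_at_def)

lemma monomial_at_Cons [simp]: "monomial_at x (j # js) (k # ns) = x k ^ j * monomial_at x js ns"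
  by (simp add: monomial_at_def prod.lessThan_Suc_shift del: prod.lessThan_Suc)

lemma truncated_sum_Nil [simp]: "truncated_sum x N [] = 1"
  by (simp add: truncated_sum_def)

lemma truncated_sum_0_Cons [simp]: "truncated_sum x 0 (j # js) = 0"
  by (simp add: truncated_sum_def)

lemma truncated_sum_Suc_Cons:
  "truncated_sum x (Suc N) (j # js) =
     truncated_sum x N (j # js) + x (Suc N) ^ j * truncated_sum x N js"
proof -
  have "truncated_indices N (Suc (length js)) \<inter> Cons (Suc N) ` truncated_indices N (length js) = {}"
    by (auto simp: truncated_indices_def)
  then show ?thesis
    by (simp add: truncated_sum_def truncated_indices_Suc_Suc finite_truncated_indices
        sum.union_disjoint sum.reindex sum_distrib_left)
qed

lemma compositions_0_right: "compositions n 0 = (if n = 0 then {[]} else {})"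
  by (auto simp: compositions_def)

lemma compositions_0_Suc: "compositions 0 (Suc d) = {}"
  by (auto simp: compositions_def length_Suc_conv)

lemma compositions_eq_empty:
  assumes "n < d"
  shows "compositions n d = {}"
proof -
  have "length js \<le> sum_list js" if "\<forall>j\<in>set js. 1 \<le> j" for js :: "nat list"
    using that by (induction js) auto
  then show ?thesis using assms by (force simp: compositions_def)
qed

text \<open>A first part 1 can be removed, a larger one lowered by 1. This mirrors splitting the
  first term off the geometric series of \<open>x k * z / (1 - x k * z)\<close>.\<close>

lemma compositions_Suc_Suc:
  "compositions (Suc n) (Suc d) =
     Cons 1 ` compositions n d \<union> (\<lambda>js. Suc (hd js) # tl js) ` compositions n (Suc d)"
proof (intro equalityI subsetI)
  fix js assume "js \<in> compositions (Suc n) (Suc d)"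
  then obtain i is' where js: "js = Suc i # is'" "length is' = d" "\<forall>j\<in>set is'. 1 \<le> j"
    "i + sum_list is' = n"
    by (auto simp: compositions_def length_Suc_conv dest!: Suc_le_D)
  show "js \<in> Cons 1 ` compositions n d \<union> (\<lambda>js. Suc (hd js) # tl js) ` compositions n (Suc d)"
  proof (cases "i = 0")
    case True
    then show ?thesis using js by (auto simp: compositions_def)
  next
    case False
    then have "i # is' \<in> compositions n (Suc d)"
      using js by (auto simp: compositions_def)
    then show ?thesis using js(1) by force
  qed
qed (auto simp: compositions_def length_Suc_conv)

lemma compositions_self: "compositions n n = {replicate n 1}"
proof (induction n)
  case (Suc n)
  then show ?case by (simp add: compositions_Suc_Suc compositions_eq_empty)
qed (simp add: compositions_0_right)

lemma truncated_T_0_right: "truncated_T x N n 0 = (if n = 0 then 1 else 0)"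
  by (simp add: truncated_T_def compositions_0_right)

lemma truncated_T_0_Suc: "truncated_T x 0 n (Suc d) = 0"
  unfolding truncated_T_def
  by (rule sum.neutral) (auto simp: compositions_def length_Suc_conv)

lemma truncated_T_eq_0: "n < d \<Longrightarrow> truncated_T x N n d = 0"
  by (simp add: truncated_T_def compositions_eq_empty)

text \<open>Raising the bound adds just the index lists with head \<open>Suc N\<close>, and this
  head meets the first exponent.\<close>

lemma truncated_T_Suc_diff:
  "truncated_T x (Suc N) n (Suc d) - truncated_T x N n (Suc d) =
     (\<Sum>js\<in>compositions n (Suc d). x (Suc N) ^ hd js * truncated_sum x N (tl js))"
proof -
  have "truncated_sum x (Suc N) js - truncated_sum x N js =
      x (Suc N) ^ hd js * truncated_sum x N (tl js)" if "js \<in> compositions n (Suc d)" for js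
    using that by (auto simp: compositions_def length_Suc_conv truncated_sum_Suc_Cons)
  then show ?thesis
    by (simp add: truncated_T_def flip: sum_subtractf)
qed

text \<open>In the difference above, first parts equal to 1 give the first summand; lowering the
  others reproduces the difference at weight \<open>n\<close>. This is multiplication by
  \<open>1 + y * x k * z / (1 - x k * z)\<close> with the denominator cleared.\<close>

lemma truncated_T_Suc_Suc_Suc:
  "truncated_T x (Suc N) (Suc n) (Suc d) - truncated_T x N (Suc n) (Suc d) =
     x (Suc N) * truncated_T x N n d
     + x (Suc N) * (truncated_T x (Suc N) n (Suc d) - truncated_T x N n (Suc d))"
proof -
  let ?h = "\<lambda>js :: nat list. Suc (hd js) # tl js"
  have hd: "1 \<le> hd js" "js = hd js # tl js" if "js \<in> compositions n (Suc d)" for js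
    using that by (cases js; auto simp: compositions_def)+
  have disj: "Cons 1 ` compositions n d \<inter> ?h ` compositions n (Suc d) = {}"
    using hd(1) by force
  have inj: "inj_on ?h (compositions n (Suc d))"
    by (rule inj_onI) (metis hd(2) list.inject nat.inject)
  have "truncated_T x (Suc N) (Suc n) (Suc d) - truncated_T x N (Suc n) (Suc d) =
      (\<Sum>js\<in>Cons 1 ` compositions n d. x (Suc N) ^ hd js * truncated_sum x N (tl js))
      + (\<Sum>js\<in>?h ` compositions n (Suc d). x (Suc N) ^ hd js * truncated_sum x N (tl js))"
    unfolding truncated_T_Suc_diff compositions_Suc_Suc
    using disj by (intro sum.union_disjoint) (simp_all add: finite_compositions)
  also have "(\<Sum>js\<in>Cons 1 ` compositions n d. x (Suc N) ^ hd js * truncated_sum x N (tl js)) =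
      x (Suc N) * truncated_T x N n d"
    by (simp add: sum.reindex truncated_T_def sum_distrib_left)
  also have "(\<Sum>js\<in>?h ` compositions n (Suc d). x (Suc N) ^ hd js * truncated_sum x N (tl js)) =
      x (Suc N) * (truncated_T x (Suc N) n (Suc d) - truncated_T x N n (Suc d))"
    unfolding truncated_T_Suc_diff
    by (subst sum.reindex[OF inj]) (simp add: sum_distrib_left mult.assoc)
  finally show ?thesis .
qed

section \<open>Generating functions of the truncated sums\<close>

definition fps_T :: "(nat \<Rightarrow> real) \<Rightarrow> nat \<Rightarrow> nat \<Rightarrow> real fps" where
  "fps_T x N d = Abs_fps (\<lambda>n. truncated_T x N n d)"

text \<open>
  Only the composition \<open>1 + \<dots> + 1 = n\<close> has \<open>n\<close> parts, so \<open>truncated_T x N n n\<close> is the \<open>n\<close>-th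
  elementary symmetric function of \<open>x 1, \<dots>, x N\<close>, and the following series is
  \<open>\<Prod>k=1..N. 1 - x k * X\<close>.
\<close>
definition fps_E :: "(nat \<Rightarrow> real) \<Rightarrow> nat \<Rightarrow> real fps" where
  "fps_E x N = Abs_fps (\<lambda>n. (-1) ^ n * truncated_T x N n n)"

lemma truncated_T_diag_Suc:
  "truncated_T x (Suc N) (Suc n) (Suc n) =
     truncated_T x N (Suc n) (Suc n) + x (Suc N) * truncated_T x N n n"
  using truncated_T_Suc_Suc_Suc[of x N n n] by (simp add: truncated_T_eq_0)

lemma fps_E_Suc: "fps_E x (Suc N) = (1 - fps_const (x (Suc N)) * fps_X) * fps_E x N"
proof (rule fps_ext)
  fix n show "fps_E x (Suc N) $ n = ((1 - fps_const (x (Suc N)) * fps_X) * fps_E x N) $ n"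
    by (cases n) (simp_all add: fps_E_def truncated_T_diag_Suc truncated_T_0_right algebra_simps)
qed

lemma fps_T_Suc:
  "(1 - fps_const (x (Suc N)) * fps_X) * fps_T x (Suc N) (Suc d) =
     (1 - fps_const (x (Suc N)) * fps_X) * fps_T x N (Suc d)
     + fps_const (x (Suc N)) * fps_X * fps_T x N d"
proof (rule fps_ext)
  fix n
  show "((1 - fps_const (x (Suc N)) * fps_X) * fps_T x (Suc N) (Suc d)) $ n =
     ((1 - fps_const (x (Suc N)) * fps_X) * fps_T x N (Suc d)
     + fps_const (x (Suc N)) * fps_X * fps_T x N d) $ n"
    using truncated_T_Suc_Suc_Suc[of x N "n - 1" d]
    by (cases n) (simp_all add: fps_T_def truncated_T_def compositions_0_Suc algebra_simps)
qed

text \<open>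
  The coefficient of \<open>y ^ d\<close> in \<open>\<Prod>k=1..N. 1 - (1 - y) * x k * X\<close>, which is the generating
  function \<open>\<Prod>k=1..N. 1 + y * x k * X / (1 - x k * X)\<close> of the \<open>fps_T x N d\<close> multiplied by
  \<open>fps_E x N\<close>.
\<close>
lemma fps_E_mult_fps_T:
  "fps_E x N * fps_T x N d =
     Abs_fps (\<lambda>n. (-1) ^ (n + d) * real (n choose d) * truncated_T x N n n)"
proof (induction N arbitrary: d)
  case 0
  have diag: "truncated_T x 0 n n = (if n = 0 then 1 else 0)" for n
    by (cases n) (simp_all add: truncated_T_0_Suc truncated_T_0_right)
  have "fps_E x 0 = 1"
    by (rule fps_ext) (simp add: fps_E_def diag)
  moreover have "fps_T x 0 d = Abs_fps (\<lambda>n. if n = 0 \<and> d = 0 then 1 else 0)"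
    by (rule fps_ext, cases d) (simp_all add: fps_T_def truncated_T_0_Suc truncated_T_0_right)
  ultimately show ?case
    by (intro fps_ext) (auto simp: diag binomial_eq_0_iff)
next
  case (Suc N)
  show ?case
  proof (cases d)
    case 0
    have "fps_T x M 0 = 1" for M
      by (rule fps_ext) (simp add: fps_T_def truncated_T_0_right)
    then show ?thesis using 0 by (simp add: fps_E_def)
  next
    case [simp]: (Suc d')
    let ?c = "fps_const (x (Suc N)) * fps_X"
    \<comment> \<open>The new factor of \<open>fps_E x (Suc N)\<close> is the denominator that
      \<open>fps_T_Suc\<close> needs cleared.\<close>
    have "fps_E x (Suc N) * fps_T x (Suc N) d =
        fps_E x N * ((1 - ?c) * fps_T x (Suc N) (Suc d'))"
      by (simp add: fps_E_Suc mult_ac)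
    also have "\<dots> = (1 - ?c) * (fps_E x N * fps_T x N (Suc d')) + ?c * (fps_E x N * fps_T x N d')"
      unfolding fps_T_Suc by (simp add: algebra_simps)
    also have "\<dots> = Abs_fps (\<lambda>n. (-1) ^ (n + d) * real (n choose d) * truncated_T x (Suc N) n n)"
      (is "?l = ?r")
    proof (rule fps_ext)
      \<comment> \<open>Pascal's rule for \<open>n choose d\<close> combines with the two-term
        recursion of the diagonal values.\<close>
      fix n show "?l $ n = ?r $ n"
        unfolding Suc.IH
        by (cases n) (simp_all add: truncated_T_diag_Suc algebra_simps)
    qed
    finally show ?thesis .
  qed
qed

section \<open>Convergence of the truncated sums\<close>

lemma truncated_sum_nonneg:
  assumes "\<And>k. 0 \<le> x k"
  shows "0 \<le> truncated_sum x N js"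
  using assms by (simp add: truncated_sum_def monomial_at_def sum_nonneg prod_nonneg)

text \<open>Since \<open>x k \<le> 1\<close>, each exponent may be lowered to 1; the remaining
  monomials all occur in the expanded power on the right. When the sums of \<open>x\<close> are
  bounded, this is uniform in \<open>N\<close>.\<close>

lemma truncated_sum_le:
  assumes "\<And>k. 0 \<le> x k" "\<And>k. x k \<le> 1" "\<forall>j\<in>set js. 1 \<le> j"
  shows "truncated_sum x N js \<le> (\<Sum>k=1..N. x k) ^ length js"
  using assms(3)
proof (induction N arbitrary: js)
  case 0
  then show ?case by (cases js) simp_all
next
  case (Suc N)
  let ?s = "\<Sum>k=1..N. x k"
  have s: "0 \<le> ?s" by (simp add: sum_nonneg assms)
  show ?case
  proof (cases js)
    case (Cons j js')
    have "x (Suc N) ^ j \<le> x (Suc N) ^ 1"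
      using Suc.prems assms Cons by (intro power_decreasing) auto
    then have "truncated_sum x (Suc N) js \<le> ?s ^ length js + x (Suc N) * ?s ^ length js'"
      using Suc.IH[of js] Suc.IH[of js'] Suc.prems assms truncated_sum_nonneg[of x N js'] Cons
      by (auto simp: truncated_sum_Suc_Cons intro!: add_mono mult_mono)
    also have "\<dots> = (?s + x (Suc N)) * ?s ^ length js'"
      by (simp add: Cons algebra_simps)
    also have "\<dots> \<le> (?s + x (Suc N)) * (?s + x (Suc N)) ^ length js'"
      using s assms by (intro mult_left_mono power_mono) auto
    finally show ?thesis by (simp add: Cons)
  qed simp
qed

text \<open>By \<open>ex\<close>, the sets \<open>D N\<close> tend to the filter of finite subsets
  of \<open>A\<close>, so the unordered sum is also the limit along \<open>D\<close>. Its existence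
  follows from the bound, as the terms are nonnegative.\<close>

lemma has_sum_exhaustion:
  fixes f :: "'a \<Rightarrow> real"
  assumes nonneg: "\<And>a. a \<in> A \<Longrightarrow> 0 \<le> f a"
    and D: "\<And>N. finite (D N)" "\<And>N. D N \<subseteq> A"
    and ex: "\<And>F. finite F \<Longrightarrow> F \<subseteq> A \<Longrightarrow> eventually (\<lambda>N. F \<subseteq> D N) sequentially"
    and bound: "\<And>N. sum f (D N) \<le> C"
  shows "(f has_sum infsum f A) A" "(\<lambda>N. sum f (D N)) \<longlonglongrightarrow> infsum f A"
proof -
  have "f summable_on A"
  proof (rule nonneg_bdd_above_summable_on[OF nonneg])
    show "bdd_above (sum f ` {F. F \<subseteq> A \<and> finite F})"
    proof (rule bdd_aboveI2)
      fix F assume "F \<in> {F. F \<subseteq> A \<and> finite F}"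
      then obtain N where "F \<subseteq> D N"
        using ex[of F] by (auto simp: eventually_sequentially)
      then have "sum f F \<le> sum f (D N)"
        using D nonneg by (intro sum_mono2) (auto dest!: subsetD)
      then show "sum f F \<le> C" using bound[of N] by linarith
    qed
  qed
  then show *: "(f has_sum infsum f A) A" by simp
  have "filterlim D (finite_subsets_at_top A) sequentially"
    using D ex by (simp add: filterlim_finite_subsets_at_top)
  then show "(\<lambda>N. sum f (D N)) \<longlonglongrightarrow> infsum f A"
    using * unfolding has_sum_def by (rule filterlim_compose[rotated])
qed

lemma truncated_indices_exhaust:
  assumes "finite F" "F \<subseteq> decr_indices d"
  shows "eventually (\<lambda>N. F \<subseteq> truncated_indices N d) sequentially"
proof -
  have "finite (\<Union>ns\<in>F. set ns)" using assms(1) by blast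
  then obtain M where "\<forall>k\<in>(\<Union>ns\<in>F. set ns). k \<le> M"
    using finite_nat_set_iff_bounded_le by metis
  then have "F \<subseteq> truncated_indices N d" if "N \<ge> M" for N
    using assms(2) that unfolding truncated_indices_def by fastforce
  then show ?thesis by (auto simp: eventually_sequentially)
qed

lemma truncated_sum_limit:
  assumes "\<And>k. 0 \<le> x k" "\<And>k. x k \<le> 1" "\<And>N. (\<Sum>k=1..N. x k) \<le> C" "\<forall>j\<in>set js. 1 \<le> j"
  defines "A \<equiv> decr_indices (length js)"
  shows "(monomial_at x js has_sum infsum (monomial_at x js) A) A"
    and "(\<lambda>N. truncated_sum x N js) \<longlonglongrightarrow> infsum (monomial_at x js) A"
proof -
  have "truncated_sum x N js \<le> C ^ length js" for N
  proof -
    have "(\<Sum>k=1..N. x k) ^ length js \<le> C ^ length js"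
      using assms by (intro power_mono) (simp_all add: sum_nonneg)
    then show ?thesis using truncated_sum_le[of x js N] assms by force
  qed
  then have bound: "sum (monomial_at x js) (truncated_indices N (length js)) \<le> C ^ length js" for N
    by (simp add: truncated_sum_def)
  have nonneg: "0 \<le> monomial_at x js ns" for ns
    by (simp add: monomial_at_def prod_nonneg assms)
  have sub: "truncated_indices N (length js) \<subseteq> A" for N
    by (auto simp: truncated_indices_def A_def)
  note * = has_sum_exhaustion[where D = "\<lambda>N. truncated_indices N (length js)" and A = A,
      OF nonneg finite_truncated_indices sub
      truncated_indices_exhaust[folded A_def] bound]
  show "(monomial_at x js has_sum infsum (monomial_at x js) A) A" by (rule *(1)) (auto simp: A_def)
  show "(\<lambda>N. truncated_sum x N js) \<longlonglongrightarrow> infsum (monomial_at x js) A"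
    unfolding truncated_sum_def by (rule *(2)) (auto simp: A_def)
qed

definition odd_inv_sq :: "nat \<Rightarrow> real" where
  "odd_inv_sq k = 1 / (2 * real k - 1) ^ 2"

lemma odd_inv_sq_nonneg: "0 \<le> odd_inv_sq k"
  by (simp add: odd_inv_sq_def)

lemma odd_inv_sq_le_1: "odd_inv_sq k \<le> 1"
proof -
  \<comment> \<open>The index 0 is covered too: there \<open>2 * real k - 1\<close> is -1.\<close>
  have "1 \<le> \<bar>2 * real k - 1\<bar>" by (cases k) auto
  then have "1 \<le> (2 * real k - 1) ^ 2" by (simp add: abs_le_square_iff[of 1, simplified])
  then show ?thesis by (auto simp: odd_inv_sq_def divide_le_eq)
qed

text \<open>Telescoping: each term after the first is at most
  \<open>1 / (2 * N + 1) - 1 / (2 * N + 3)\<close>. The induction therefore carries the sharper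
  bound \<open>2 - 1 / (2 * N + 1)\<close>.\<close>

lemma sum_odd_inv_sq_le: "(\<Sum>k=1..N. odd_inv_sq k) \<le> 2"
proof -
  have "(\<Sum>k=1..Suc N. odd_inv_sq k) \<le> 2 - 1 / (2 * real N + 1)" for N
  proof (induction N)
    case 0
    then show ?case by (simp add: odd_inv_sq_def)
  next
    case (Suc N)
    have "odd_inv_sq (Suc (Suc N)) = 1 / (2 * real N + 3) ^ 2"
      by (simp add: odd_inv_sq_def algebra_simps)
    also have "\<dots> \<le> 1 / ((2 * real N + 1) * (2 * real N + 3))"
      by (intro divide_left_mono) (auto simp: power2_eq_square intro!: mult_right_mono)
    also have "\<dots> \<le> 2 / ((2 * real N + 1) * (2 * real N + 3))"
      by (intro divide_right_mono) auto
    also have "\<dots> = 1 / (2 * real N + 1) - 1 / (2 * real (Suc N) + 1)"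
      by (simp add: divide_simps)
    finally show ?case using Suc by simp
  qed
  from this[of N] have "(\<Sum>k=1..Suc N. odd_inv_sq k) \<le> 2"
    by (smt (verit) divide_nonneg_nonneg of_nat_0_le_iff)
  then show ?thesis using odd_inv_sq_nonneg[of "Suc N"] by simp
qed

lemma mtv_map_double:
  "mtv (map (\<lambda>j. 2 * j) js) = infsum (monomial_at odd_inv_sq js) (decr_indices (length js))"
  by (auto simp: mtv_def monomial_at_def odd_inv_sq_def power_mult power_divide
      intro!: infsum_cong prod.cong)

lemma truncated_T_limit: "(\<lambda>N. truncated_T odd_inv_sq N n d) \<longlonglongrightarrow> T_even n d"
  unfolding truncated_T_def T_even_def
proof (rule tendsto_sum)
  fix js assume "js \<in> compositions n d"
  then have "\<forall>j\<in>set js. 1 \<le> j" by (simp add: compositions_def)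
  from truncated_sum_limit(2)[OF odd_inv_sq_nonneg odd_inv_sq_le_1 sum_odd_inv_sq_le this]
  show "(\<lambda>N. truncated_sum odd_inv_sq N js) \<longlonglongrightarrow> mtv (map ((*) 2) js)"
    by (simp add: mtv_map_double)
qed

section \<open>The cosine product and the diagonal values \<open>T_even n n\<close>\<close>

lemma sums_fps_E: "(\<lambda>n. fps_E x N $ n * z ^ n) sums (\<Prod>k=1..N. 1 - x k * z)"
proof (induction N)
  case 0
  have "fps_E x 0 $ n * z ^ n = (if n = 0 then 1 else 0)" for n
    by (cases n) (simp_all add: fps_E_def truncated_T_0_right truncated_T_0_Suc)
  then show ?case using sums_single[of 0 "\<lambda>_. 1 :: real"] by simp
next
  case (Suc N)
  let ?P = "\<Prod>k=1..N. 1 - x k * z"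
  have "(\<lambda>n. fps_E x N $ Suc n * z ^ Suc n) sums (?P - 1)"
    using Suc by (subst sums_Suc_iff) (simp add: fps_E_def truncated_T_0_right)
  from sums_diff[OF this sums_mult[OF Suc, of "x (Suc N) * z"]]
  have "(\<lambda>n. fps_E x (Suc N) $ Suc n * z ^ Suc n) sums (?P - 1 - x (Suc N) * z * ?P)"
    by (simp add: fps_E_Suc algebra_simps)
  from sums_Suc[OF this] show ?case
    by (simp add: fps_E_def truncated_T_0_right algebra_simps)
qed

text \<open>Uses \<open>cos u = sin (2 * u) / (2 * sin u)\<close> for \<open>u = pi / 2 * w\<close>.
  In the sine product for \<open>pi * w\<close>, the factors with even index form the product for
  \<open>u\<close>, and the odd ones remain. The bound on \<open>w\<close> keeps the divisors
  nonzero.\<close>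

lemma cos_product_limit:
  assumes "w \<noteq> 0" "\<bar>w\<bar> < 2"
  shows "(\<lambda>N. \<Prod>k=1..N. 1 - odd_inv_sq k * w ^ 2) \<longlonglongrightarrow> cos (pi / 2 * w)"
proof -
  define f where "f = (\<lambda>N. \<Prod>k=1..N. 1 - w ^ 2 / real k ^ 2)"
  define g where "g = (\<lambda>N. \<Prod>k=1..N. 1 - (w / 2) ^ 2 / real k ^ 2)"
  have split: "f (2 * N) = g N * (\<Prod>k=1..N. 1 - odd_inv_sq k * w ^ 2)" for N
  proof (induction N)
    case (Suc N)
    have "f (2 * Suc N) = f (2 * N) * (1 - w ^ 2 / (2 * real N + 1) ^ 2)
        * (1 - w ^ 2 / (2 * real N + 2) ^ 2)"
      by (simp add: f_def add_ac)
    moreover have "g (Suc N) = g N * (1 - w ^ 2 / (2 * real N + 2) ^ 2)"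
    proof -
      have "(2 * real N + 2) ^ 2 = 4 * real (Suc N) ^ 2"
        by (simp add: power2_eq_square algebra_simps)
      then show ?thesis by (simp add: g_def power_divide)
    qed
    moreover have "odd_inv_sq (Suc N) = 1 / (2 * real N + 1) ^ 2"
      by (simp add: odd_inv_sq_def algebra_simps)
    ultimately show ?case using Suc by simp
  qed (simp add: f_def g_def)
  have s: "sin (pi * (w / 2)) \<noteq> 0"
  proof
    assume "sin (pi * (w / 2)) = 0"
    moreover have "\<bar>pi * (w / 2)\<bar> < pi"
      using assms by (simp add: abs_mult)
    ultimately have "pi * (w / 2) = 0"
      using sin_eq_0_pi[of "pi * (w / 2)"] by linarith
    then show False using assms by simp
  qed
  have f: "(\<lambda>N. f (2 * N)) \<longlonglongrightarrow> sin (pi * w) / (pi * w)"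
    using LIMSEQ_subseq_LIMSEQ[OF sin_product_formula_real'[OF assms(1)], of "\<lambda>N. 2 * N"]
    by (simp add: f_def strict_mono_def o_def)
  have g: "g \<longlonglongrightarrow> sin (pi * (w / 2)) / (pi * (w / 2))"
    unfolding g_def using sin_product_formula_real'[of "w / 2"] assms by simp
  have "(\<lambda>N. f (2 * N) / g N) \<longlonglongrightarrow>
      (sin (pi * w) / (pi * w)) / (sin (pi * (w / 2)) / (pi * (w / 2)))"
    using s assms by (intro tendsto_divide f g) auto
  also have "sin (pi * w) = 2 * sin (pi * (w / 2)) * cos (pi * (w / 2))"
    by (simp flip: sin_double)
  finally have "(\<lambda>N. f (2 * N) / g N) \<longlonglongrightarrow> cos (pi / 2 * w)"
    using s assms by (simp add: field_simps)
  moreover have "g N \<noteq> 0" for N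
  proof -
    have "(w / 2) ^ 2 < 1" using assms by (simp add: abs_square_less_1)
    then have "(w / 2) ^ 2 / real k ^ 2 \<noteq> 1" if "1 \<le> k" for k
    proof -
      have "1 \<le> real k ^ 2" using that by simp
      then have "(w / 2) ^ 2 \<noteq> real k ^ 2" using \<open>(w / 2) ^ 2 < 1\<close> by linarith
      then show ?thesis using that by (simp add: divide_eq_1_iff)
    qed
    then show ?thesis by (auto simp: g_def)
  qed
  ultimately show ?thesis by (simp add: split)
qed

lemma truncated_T_diag_bounds: "0 \<le> truncated_T odd_inv_sq N n n" "truncated_T odd_inv_sq N n n \<le> 2 ^ n"
proof -
  have T: "truncated_T odd_inv_sq N n n = truncated_sum odd_inv_sq N (replicate n 1)"
    by (simp add: truncated_T_def compositions_self)
  show "0 \<le> truncated_T odd_inv_sq N n n"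
    unfolding T by (rule truncated_sum_nonneg[OF odd_inv_sq_nonneg])
  have "truncated_T odd_inv_sq N n n \<le> (\<Sum>k=1..N. odd_inv_sq k) ^ n"
    unfolding T using truncated_sum_le[OF odd_inv_sq_nonneg odd_inv_sq_le_1, where js = "replicate n 1"]
    by simp
  also have "\<dots> \<le> 2 ^ n"
    by (intro power_mono sum_odd_inv_sq_le sum_nonneg odd_inv_sq_nonneg)
  finally show "truncated_T odd_inv_sq N n n \<le> 2 ^ n" .
qed

text \<open>Tannery's theorem exchanges the limit in \<open>N\<close> with the power series. As
  \<open>w ^ 2 \<le> 1 / 4\<close> and the diagonal values are at most \<open>2 ^ n\<close>, the
  geometric series of ratio 1/2 dominates for every \<open>N\<close>.\<close>

lemma sums_T_even_diag:
  assumes "w \<noteq> 0" "\<bar>w\<bar> \<le> 1 / 2"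
  shows "(\<lambda>n. (-1) ^ n * T_even n n * (w ^ 2) ^ n) sums cos (pi / 2 * w)"
proof -
  let ?a = "\<lambda>n N. fps_E odd_inv_sq N $ n * (w ^ 2) ^ n"
  let ?b = "\<lambda>n. (-1) ^ n * T_even n n * (w ^ 2) ^ n"
  have "w ^ 2 \<le> (1 / 2) ^ 2" using assms by (simp add: abs_le_square_iff[symmetric])
  then have w: "w ^ 2 \<le> 1 / 4" by (simp add: power2_eq_square)
  have bound: "norm (?a n N) \<le> (1 / 2) ^ n" for n N
  proof -
    have "norm (?a n N) = truncated_T odd_inv_sq N n n * (w ^ 2) ^ n"
      by (simp add: fps_E_def abs_mult truncated_T_diag_bounds)
    also have "\<dots> \<le> 2 ^ n * (1 / 4) ^ n"
      using w by (intro mult_mono power_mono truncated_T_diag_bounds) auto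
    also have "\<dots> = (1 / 2) ^ n" by (simp flip: power_mult_distrib)
    finally show ?thesis .
  qed
  have lim: "(\<lambda>N. ?a n N) \<longlonglongrightarrow> ?b n" for n
    unfolding fps_E_def by (simp, intro tendsto_intros truncated_T_limit)
  have ev: "eventually (\<lambda>(n, N). norm (?a n N) \<le> (1 / 2) ^ n) (at_top \<times>\<^sub>F sequentially)"
    using bound by (intro always_eventually) auto
  note * = tannerys_theorem[OF lim ev]
  have "(\<lambda>N. \<Sum>n. ?a n N) \<longlonglongrightarrow> suminf ?b"
    and sm: "summable (\<lambda>n. norm (?b n))"
    using * by (simp_all add: summable_geometric)
  moreover have "(\<Sum>n. ?a n N) = (\<Prod>k=1..N. 1 - odd_inv_sq k * w ^ 2)" for N
    using sums_fps_E sums_unique by metis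
  ultimately have "(\<lambda>N. \<Prod>k=1..N. 1 - odd_inv_sq k * w ^ 2) \<longlonglongrightarrow> suminf ?b"
    by simp
  then have "suminf ?b = cos (pi / 2 * w)"
    using LIMSEQ_unique cos_product_limit[of w] assms by force
  moreover have "summable ?b" using sm by (rule summable_norm_cancel)
  ultimately show ?thesis by (simp add: sums_iff)
qed

text \<open>Comparison with the cosine series. The difference series \<open>a\<close> vanishes for
  all small positive \<open>z\<close>, while zeros of a nonzero power series are isolated.\<close>

lemma T_even_diag: "T_even n n = (pi\<^sup>2 / 4) ^ n / fact (2 * n)"
proof -
  define a where "a = (\<lambda>n. (-1) ^ n * (T_even n n - (pi\<^sup>2 / 4) ^ n / fact (2 * n)))"
  have pos: "(\<lambda>n. a n * z ^ n) sums 0" if "0 < z" "z \<le> 1 / 4" for z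
  proof -
    have w: "sqrt z \<noteq> 0" "\<bar>sqrt z\<bar> \<le> 1 / 2" "(sqrt z)\<^sup>2 = z"
      using that real_sqrt_le_mono[of z "1 / 4"] by (auto simp: real_sqrt_divide)
    have "(pi / 2 * sqrt z) ^ (2 * n) = (pi\<^sup>2 / 4) ^ n * z ^ n" for n
      using w(3) by (simp add: power_mult power_mult_distrib power_divide)
    then have "(\<lambda>n. (-1) ^ n / fact (2 * n) * ((pi\<^sup>2 / 4) ^ n * z ^ n)) sums cos (pi / 2 * sqrt z)"
      using cos_paired[of "pi / 2 * sqrt z"] by simp
    from sums_diff[OF sums_T_even_diag[OF w(1,2)] this]
    show ?thesis by (simp add: w(3) a_def algebra_simps)
  qed
  have sm: "(\<lambda>n. a n * (z - 0) ^ n) sums (\<Sum>n. a n * z ^ n)" if "norm (z - 0) < 1 / 4" for z :: real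
  proof -
    have "summable (\<lambda>n. a n * (1 / 4) ^ n)" using pos[of "1/4"] by (simp add: sums_iff)
    from powser_inside[OF this, of z] have "summable (\<lambda>n. a n * z ^ n)" using that by simp
    then show ?thesis by (simp add: summable_sums)
  qed
  \<comment> \<open>The constant term is settled separately: \<open>powser_0_nonzero\<close>
    concerns a series vanishing at its centre with a nonzero coefficient of positive index.\<close>
  have "T_even 0 0 = 1"
    using truncated_T_limit[of 0 0] by (simp add: truncated_T_0_right LIMSEQ_const_iff)
  then have a0: "a 0 = 0" by (simp add: a_def)
  have "a n = 0"
  proof (rule ccontr)
    assume an: "a n \<noteq> 0"
    with a0 have "0 < n" by (cases n) auto
    moreover have "(\<Sum>n. a n * 0 ^ n) = 0" using a0 by simp
    ultimately obtain s :: real where s: "0 < s" "\<And>z. z \<in> cball 0 s - {0} \<Longrightarrow> (\<Sum>n. a n * z ^ n) \<noteq> 0"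
      using powser_0_nonzero[of "1 / 4" 0 a, OF _ sm _ an] by auto
    have "(\<Sum>n. a n * (min s (1 / 4)) ^ n) = 0"
      using pos[of "min s (1 / 4)"] s(1) by (simp add: sums_iff)
    then show False using s(2)[of "min s (1 / 4)"] s(1) by auto
  qed
  then show ?thesis by (simp add: a_def)
qed

section \<open>The three-term recurrence in the depth \<open>d\<close> and its solution\<close>

definition fps_cos_sqrt :: "real fps" where
  "fps_cos_sqrt = Abs_fps (\<lambda>n. (-1) ^ n * T_even n n)"

definition fps_T_even :: "nat \<Rightarrow> real fps" where
  "fps_T_even d = Abs_fps (\<lambda>n. T_even n d)"

text \<open>Limit of \<open>fps_E_mult_fps_T\<close>, taken coefficientwise: each coefficient of a
  product is a finite sum.\<close>

lemma fps_cos_sqrt_mult_T_even: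
  "fps_cos_sqrt * fps_T_even d = Abs_fps (\<lambda>n. (-1) ^ (n + d) * real (n choose d) * T_even n n)"
proof (rule fps_ext)
  fix n
  have "(\<lambda>N. (fps_E odd_inv_sq N * fps_T odd_inv_sq N d) $ n) \<longlonglongrightarrow>
      (fps_cos_sqrt * fps_T_even d) $ n"
    unfolding fps_mult_nth fps_E_def fps_T_def fps_cos_sqrt_def fps_T_even_def fps_nth_Abs_fps
    by (intro tendsto_intros truncated_T_limit)
  moreover have "(\<lambda>N. (fps_E odd_inv_sq N * fps_T odd_inv_sq N d) $ n) \<longlonglongrightarrow>
      (-1) ^ (n + d) * real (n choose d) * T_even n n"
    unfolding fps_E_mult_fps_T fps_nth_Abs_fps by (intro tendsto_intros truncated_T_limit)
  ultimately show "(fps_cos_sqrt * fps_T_even d) $ n =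
      Abs_fps (\<lambda>n. (-1) ^ (n + d) * real (n choose d) * T_even n n) $ n"
    using LIMSEQ_unique by fastforce
qed

lemma Suc_times_binomial_Suc:
  "real (Suc k) * real (n choose Suc k) = (real n - real k) * real (n choose k)"
proof (cases "k \<le> n")
  case True
  have "Suc k * (n choose Suc k) = (n - k) * (n choose k)"
    by (simp only: binomial_absorption binomial_absorb_comp)
  then have "real (Suc k * (n choose Suc k)) = real ((n - k) * (n choose k))" by simp
  then show ?thesis using True by (simp only: of_nat_mult of_nat_diff)
qed (simp add: not_le binomial_eq_0)

lemma fps_nth_0_cos_sqrt: "fps_cos_sqrt $ 0 = 1"
  by (simp add: fps_cos_sqrt_def T_even_diag)

text \<open>
  Multiplied by \<open>fps_cos_sqrt\<close>, the series \<open>fps_T_even d\<close> becomes the coefficient of \<open>y ^ d\<close> in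
  \<open>F = cos (b * sqrt (1 - y))\<close> with \<open>b = pi / 2 * sqrt X\<close>. The recurrence expresses the
  differential equation \<open>4 * (1 - y) * F'' - 2 * F' + b\<^sup>2 * F = 0\<close> with respect to \<open>y\<close>.
\<close>
lemma T_even_recurrence:
  "4 * (real d + 2) * (real d + 1) * T_even (Suc n) (Suc (Suc d)) =
     (4 * real d + 2) * (real d + 1) * T_even (Suc n) (Suc d) - pi\<^sup>2 / 4 * T_even n d"
proof -
  let ?l = "4 * (real d + 2) * (real d + 1)" and ?r = "(4 * real d + 2) * (real d + 1)"
  let ?F = "\<lambda>d. Abs_fps (\<lambda>n. (-1) ^ (n + d) * real (n choose d) * T_even n n)"
  have "fps_const ?l * ?F (Suc (Suc d)) =
      fps_const ?r * ?F (Suc d) - fps_const (pi\<^sup>2 / 4) * fps_X * ?F d" (is "?L = ?R")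
  proof (rule fps_ext)
    fix n show "?L $ n = ?R $ n"
    proof (cases n)
      case (Suc m)
      \<comment> \<open>The ratio of consecutive cosine coefficients brings all three terms to the
        same diagonal value.\<close>
      have e: "pi\<^sup>2 / 4 * T_even m m = (2 * real m + 2) * (2 * real m + 1) * T_even (Suc m) (Suc m)"
      proof -
        define P where "P = (2 * real m + 2) * (2 * real m + 1)"
        have "P \<noteq> 0" by (simp add: P_def add_nonneg_eq_0_iff)
        have fact: "fact (2 * Suc m) = P * fact (2 * m)"
          by (simp add: P_def algebra_simps)
        show ?thesis
          unfolding T_even_diag P_def[symmetric] fact using \<open>P \<noteq> 0\<close> by simp
      qed
      have "?l * real (Suc m choose Suc (Suc d)) + ?r * real (Suc m choose Suc d) =
          4 * (real d + 1) * ((real d + 2) * real (Suc m choose Suc (Suc d)))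
          + ?r * real (Suc m choose Suc d)" by (simp add: algebra_simps del: binomial_Suc_Suc)
      also have "(real d + 2) * real (Suc m choose Suc (Suc d)) =
          (real m - real d) * real (Suc m choose Suc d)"
        using Suc_times_binomial_Suc[of "Suc d" "Suc m"]
        by (simp add: add.commute del: binomial_Suc_Suc)
      also have "4 * (real d + 1) * ((real m - real d) * real (Suc m choose Suc d))
          + ?r * real (Suc m choose Suc d) =
          (4 * real m + 2) * ((real d + 1) * real (Suc m choose Suc d))"
        by (simp add: algebra_simps del: binomial_Suc_Suc)
      also have "(real d + 1) * real (Suc m choose Suc d) = (real m + 1) * real (m choose d)"
      proof -
        have "real (Suc d * (Suc m choose Suc d)) = real (Suc m * (m choose d))"
          by (simp only: Suc_times_binomial)
        then show ?thesis by (simp only: of_nat_mult of_nat_Suc add.commute)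
      qed
      finally have b: "?l * real (Suc m choose Suc (Suc d)) + ?r * real (Suc m choose Suc d) =
          (2 * real m + 2) * (2 * real m + 1) * real (m choose d)"
        by (simp add: algebra_simps)
      have "?L $ n - fps_nth (fps_const ?r * ?F (Suc d)) n =
          (-1) ^ (Suc m + d) * T_even (Suc m) (Suc m) *
            (?l * real (Suc m choose Suc (Suc d)) + ?r * real (Suc m choose Suc d))"
        by (simp add: Suc algebra_simps del: binomial_Suc_Suc)
      also have "\<dots> = (-1) ^ (Suc m + d) * real (m choose d) * (pi\<^sup>2 / 4 * T_even m m)"
        unfolding b e by simp
      also have "\<dots> = - fps_nth (fps_const (pi\<^sup>2 / 4) * fps_X * ?F d) n"
        by (simp add: Suc mult.assoc)
      finally show ?thesis by simp
    qed simp
  qed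
  then have "fps_cos_sqrt * (fps_const ?l * fps_T_even (Suc (Suc d))) =
      fps_cos_sqrt * (fps_const ?r * fps_T_even (Suc d) - fps_const (pi\<^sup>2 / 4) * fps_X * fps_T_even d)"
    unfolding fps_cos_sqrt_mult_T_even[symmetric] by (simp only: algebra_simps)
  \<comment> \<open>Formal power series over the reals have no zero divisors, so the cosine factor
    cancels.\<close>
  moreover have "fps_cos_sqrt \<noteq> 0" using fps_nth_0_cos_sqrt by auto
  ultimately have "fps_const ?l * fps_T_even (Suc (Suc d)) =
      fps_const ?r * fps_T_even (Suc d) - fps_const (pi\<^sup>2 / 4) * fps_X * fps_T_even d"
    by simp
  then have "(fps_const ?l * fps_T_even (Suc (Suc d))) $ Suc n =
      (fps_const ?r * fps_T_even (Suc d) - fps_const (pi\<^sup>2 / 4) * fps_X * fps_T_even d) $ Suc n"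
    by simp
  then show ?thesis by (simp add: fps_T_even_def mult.assoc)
qed

text \<open>The coefficient of \<open>b ^ (2 * j)\<close> in the polynomial \<open>p d\<close>. The
  cutoff is explicit because for \<open>d = 1\<close> and \<open>j \<ge> 1\<close> truncated
  subtraction would yield \<open>0 choose 0 = 1\<close>; it also makes \<open>p 0\<close>
  zero.\<close>

definition T_coeff :: "nat \<Rightarrow> nat \<Rightarrow> real" where
  "T_coeff d j =
     (if 2 * j < d
      then (-1) ^ j * 4 ^ j / (4 ^ (d - 1) * fact (2 * j) * real d) * real ((2 * d - 2 * j - 2) choose (d - 1))
      else 0)"

text \<open>Absorption reduces every binomial to \<open>M choose (d - 1)\<close>. What remains is a
  polynomial identity after substituting \<open>2 * j = 2 * d - M\<close>.\<close>

lemma central_binomial_identity: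
  fixes d j M :: nat
  assumes "real M = 2 * real d - 2 * real j" "1 \<le> d"
  shows "real d * ((real d + 1) * real (Suc (Suc M) choose Suc d)) =
    real d * ((4 * real d + 2) * real (M choose d)) + 2 * real j * (2 * real j - 1) * real (M choose (d - 1))"
proof -
  obtain k where d: "d = Suc k" using assms(2) by (cases d) auto
  define B where "B = real (M choose k)"
  have 1: "real d * real (M choose d) = (real M - real k) * B"
    using Suc_times_binomial_Suc[of k M] by (simp only: d B_def)
  have "real d * real (Suc M choose d) = (real M + 1) * B"
    using 1 by (simp add: d B_def algebra_simps)
  moreover have "(real d + 1) * real (Suc (Suc M) choose Suc d) = (real M + 2) * real (Suc M choose d)"
  proof -
    have "real (Suc d * (Suc (Suc M) choose Suc d)) = real (Suc (Suc M) * (Suc M choose d))"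
      by (simp only: Suc_times_binomial)
    then show ?thesis by (simp only: of_nat_mult of_nat_Suc) (simp only: algebra_simps)
  qed
  ultimately have "real d * ((real d + 1) * real (Suc (Suc M) choose Suc d)) = (real M + 2) * ((real M + 1) * B)"
    by (metis mult.left_commute)
  also have "\<dots> = (4 * real d + 2) * ((real M - real k) * B) + 2 * real j * (2 * real j - 1) * B"
  proof -
    have "2 * real j = 2 * real d - real M" using assms by simp
    then show ?thesis by (simp only:) (simp add: d algebra_simps)
  qed
  also have "\<dots> = (4 * real d + 2) * (real d * real (M choose d)) + 2 * real j * (2 * real j - 1) * B"
    by (simp only: 1)
  finally show ?thesis by (simp only: d B_def diff_Suc_1 mult.left_commute)
qed

text \<open>This is \<open>T_even_recurrence\<close> read off at \<open>b ^ (2 * j)\<close>: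
  multiplication by \<open>b\<^sup>2\<close> shifts \<open>j\<close> by one. Away from the boundary
  cases it is \<open>central_binomial_identity\<close> times the common factor
  \<open>q / d\<close>.\<close>

lemma T_coeff_recurrence:
  "4 * (real d + 2) * (real d + 1) * T_coeff (Suc (Suc d)) j =
     (4 * real d + 2) * (real d + 1) * T_coeff (Suc d) j - (if j = 0 then 0 else T_coeff d (j - 1))"
proof (cases "d = 0 \<or> d + 2 \<le> 2 * j")
  case True
  then show ?thesis by (auto simp: T_coeff_def)
next
  case False
  then have d: "1 \<le> d" "2 * j < d + 2" "j \<le> d" by auto
  define M where "M = 2 * d - 2 * j"
  have M: "real M = 2 * real d - 2 * real j" using d by (simp add: M_def)
  define q where "q = (-1) ^ j * 4 ^ j / (4 ^ d * fact (2 * j) :: real)"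
  have 2: "4 * (real d + 2) * T_coeff (Suc (Suc d)) j = q * real (Suc (Suc M) choose Suc d)"
  proof -
    have "2 * Suc (Suc d) - 2 * j - 2 = Suc (Suc M)" using d by (simp add: M_def)
    moreover have "4 * r * (a / (4 ^ Suc d * f * r) * b) = a / (4 ^ d * f) * b"
      if "r \<noteq> 0" for a b f r :: real
      using that by simp
    from this[of "real d + 2"]
    have "4 * (real d + 2) * (a / (4 ^ Suc d * f * real (Suc (Suc d))) * b) = a / (4 ^ d * f) * b"
      for a b f :: real
      by (simp add: add_ac add_nonneg_eq_0_iff)
    ultimately show ?thesis using d(2)
      unfolding T_coeff_def q_def by (simp only: diff_Suc_1 if_True) simp
  qed
  have 1: "(real d + 1) * T_coeff (Suc d) j = q * real (M choose d)"
  proof -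
    have *: "2 * Suc d - 2 * j - 2 = M" using d by (simp add: M_def)
    show ?thesis
    proof (cases "2 * j < Suc d")
      case True
      then have "real (Suc d) * T_coeff (Suc d) j = q * real (M choose d)"
        unfolding T_coeff_def * by (simp add: q_def add_nonneg_eq_0_iff)
      then show ?thesis by (simp only: of_nat_Suc add.commute)
    next
      case False
      \<comment> \<open>Here \<open>2 * j = d + 1\<close>, and the zero from the cutoff agrees with
        \<open>M choose d = 0\<close>.\<close>
      then have "M < d" using d unfolding M_def by linarith
      then show ?thesis using False by (simp add: T_coeff_def)
    qed
  qed
  have 0: "real d * (if j = 0 then 0 else T_coeff d (j - 1)) =
      - q * (2 * real j * (2 * real j - 1) * real (M choose (d - 1)))"
  proof (cases j)
    case (Suc i)
    have *: "2 * d - 2 * i - 2 = M" "2 * i < d" using d Suc by (auto simp: M_def)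
    obtain k where k: "d = Suc k" using d(1) by (cases d) auto
    define P where "P = (2 * real i + 2) * (2 * real i + 1)"
    have "P \<noteq> 0" by (simp add: P_def add_nonneg_eq_0_iff)
    have fact: "fact (2 * Suc i) = P * fact (2 * i)"
      by (simp add: P_def algebra_simps)
    have "2 * real j * (2 * real j - 1) = P"
      by (simp add: Suc P_def algebra_simps)
    moreover have "q * P = - ((-1) ^ i * 4 ^ i / (4 ^ k * fact (2 * i)))"
      using \<open>P \<noteq> 0\<close> unfolding q_def Suc fact k by simp
    moreover have "real d * T_coeff d i = (-1) ^ i * 4 ^ i / (4 ^ k * fact (2 * i)) * real (M choose (d - 1))"
      unfolding T_coeff_def using * d(1) by (simp add: k add_nonneg_eq_0_iff)
    ultimately have "real d * T_coeff d i = - (q * (2 * real j * (2 * real j - 1))) * real (M choose (d - 1))"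
      by simp
    then show ?thesis by (simp add: Suc)
  qed simp
  have "real d * (4 * (real d + 2) * (real d + 1) * T_coeff (Suc (Suc d)) j) =
      q * (real d * ((real d + 1) * real (Suc (Suc M) choose Suc d)))"
    using 2 by (simp only: mult_ac)
  also have "\<dots> = real d * (4 * real d + 2) * (q * real (M choose d))
      - - q * (2 * real j * (2 * real j - 1) * real (M choose (d - 1)))"
    unfolding central_binomial_identity[OF M d(1)] by (simp add: algebra_simps)
  also have "\<dots> = real d * ((4 * real d + 2) * (real d + 1) * T_coeff (Suc d) j
      - (if j = 0 then 0 else T_coeff d (j - 1)))"
    unfolding 0[symmetric] 1[symmetric] by (simp only: algebra_simps)
  finally show ?thesis using d(1) by (simp only: mult_cancel_left) simp
qed

text \<open>Both sides obey the same recurrence and agree for \<open>d = 0\<close> and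
  \<open>d = 1\<close>. It leads from \<open>(n, d + 2)\<close> to \<open>(n, d + 1)\<close> and
  \<open>(n - 1, d)\<close>, so the region \<open>d \<le> n\<close> is never left and
  \<open>q d\<close> does not appear. At \<open>d = 0\<close>, \<open>1 \<le> n\<close> excludes
  \<open>T_even 0 0 = 1\<close>.\<close>

lemma T_even_eq_sum_T_coeff:
  assumes "1 \<le> n" "d \<le> n"
  shows "T_even n d = (\<Sum>j\<le>n. T_coeff d j * (pi\<^sup>2 / 4) ^ j * T_even (n - j) 1)"
  using assms
proof (induction d arbitrary: n rule: induct_nat_012)
  case 0
  then show ?case by (simp add: T_even_def compositions_0_right T_coeff_def)
next
  case 1
  have "(\<Sum>j\<le>n. T_coeff 1 j * (pi\<^sup>2 / 4) ^ j * T_even (n - j) 1) =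
      (\<Sum>j\<in>{0}. T_coeff 1 j * (pi\<^sup>2 / 4) ^ j * T_even (n - j) 1)"
    by (rule sum.mono_neutral_right) (auto simp: T_coeff_def)
  then show ?case by (simp add: T_coeff_def)
next
  case (ge2 d)
  then obtain m where m: "n = Suc m" "1 \<le> m" "d \<le> m" by (cases n) auto
  let ?c = "pi\<^sup>2 / 4"
  let ?t = "\<lambda>j. ?c ^ j * T_even (n - j) 1"
  let ?l = "4 * (real d + 2) * (real d + 1)" and ?r = "(4 * real d + 2) * (real d + 1)"
  have "?c * T_even m d = (\<Sum>j\<le>m. T_coeff d j * ?t (Suc j))"
    using ge2.IH(1)[of m] m by (simp add: sum_distrib_left mult_ac)
  also have "\<dots> = (\<Sum>j\<le>n. (if j = 0 then 0 else T_coeff d (j - 1)) * ?t j)"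
    unfolding m(1) sum.atMost_Suc_shift by simp
  finally have m_d: "?c * T_even m d = (\<Sum>j\<le>n. (if j = 0 then 0 else T_coeff d (j - 1)) * ?t j)" .
  have n_Suc_d: "T_even n (Suc d) = (\<Sum>j\<le>n. T_coeff (Suc d) j * ?t j)"
    using ge2.IH(2)[of n] ge2.prems by (simp only: mult.assoc)
  have "?l * T_even n (Suc (Suc d)) = ?r * (\<Sum>j\<le>n. T_coeff (Suc d) j * ?t j)
      - (\<Sum>j\<le>n. (if j = 0 then 0 else T_coeff d (j - 1)) * ?t j)"
    using T_even_recurrence[of d m] unfolding m(1)[symmetric] m_d n_Suc_d .
  also have "\<dots> = (\<Sum>j\<le>n. (?r * T_coeff (Suc d) j - (if j = 0 then 0 else T_coeff d (j - 1))) * ?t j)"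
    by (simp only: sum_distrib_left left_diff_distrib sum_subtractf mult.assoc)
  also have "\<dots> = ?l * (\<Sum>j\<le>n. T_coeff (Suc (Suc d)) j * ?t j)"
    unfolding T_coeff_recurrence[symmetric] by (simp only: sum_distrib_left mult.assoc)
  finally have "?l * T_even n (Suc (Suc d)) = ?l * (\<Sum>j\<le>n. T_coeff (Suc (Suc d)) j * ?t j)" .
  moreover have "?l \<noteq> 0" by (simp add: add_nonneg_eq_0_iff)
  ultimately show ?case by (simp only: mult_cancel_left mult.assoc) simp
qed

lemma T_even_1: "1 \<le> n \<Longrightarrow> T_even n 1 = mtv [2 * n]"
proof -
  assume "1 \<le> n"
  then have "compositions n 1 = {[n]}" by (auto simp: compositions_def length_Suc_conv)
  then show ?thesis by (simp add: T_even_def)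
qed

lemma T_even_formula:
  assumes "1 \<le> d" "d \<le> n"
  shows "T_even n d = (\<Sum>j=0..(d - 1) div 2.
      (-1) ^ j * pi ^ (2 * j) / (2 ^ (2 * d - 2) * fact (2 * j) * real d)
      * real ((2 * d - 2 * j - 2) choose (d - 1)) * mtv [2 * n - 2 * j])"
proof -
  have "T_even n d = (\<Sum>j\<le>n. T_coeff d j * (pi\<^sup>2 / 4) ^ j * T_even (n - j) 1)"
    using assms by (intro T_even_eq_sum_T_coeff) auto
  also have "\<dots> = (\<Sum>j=0..(d - 1) div 2. T_coeff d j * (pi\<^sup>2 / 4) ^ j * T_even (n - j) 1)"
    using assms by (intro sum.mono_neutral_right) (auto simp: T_coeff_def)
  also have "\<dots> = (\<Sum>j=0..(d - 1) div 2.
      (-1) ^ j * pi ^ (2 * j) / (2 ^ (2 * d - 2) * fact (2 * j) * real d)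
      * real ((2 * d - 2 * j - 2) choose (d - 1)) * mtv [2 * n - 2 * j])"
  proof (rule sum.cong[OF refl])
    fix j assume "j \<in> {0..(d - 1) div 2}"
    then have j: "2 * j < d" using assms by auto
    have "2 * d - 2 = 2 * (d - 1)" by simp
    then have "(4 :: real) ^ (d - 1) = 2 ^ (2 * d - 2)"
      by (simp only: power_mult) simp
    moreover have "T_even (n - j) 1 = mtv [2 * n - 2 * j]"
      using j assms T_even_1[of "n - j"] by (simp add: diff_mult_distrib2)
    moreover have "(pi\<^sup>2 / 4) ^ j = pi ^ (2 * j) / 4 ^ j"
      by (simp add: power_divide power_mult)
    ultimately show "T_coeff d j * (pi\<^sup>2 / 4) ^ j * T_even (n - j) 1 =
        (-1) ^ j * pi ^ (2 * j) / (2 ^ (2 * d - 2) * fact (2 * j) * real d)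
        * real ((2 * d - 2 * j - 2) choose (d - 1)) * mtv [2 * n - 2 * j]"
      using j by (simp add: T_coeff_def mult_ac)
  qed
  finally show ?thesis .
qed

section \<open>Single t-values and the zeta function\<close>

lemma has_sum_mtv_single:
  assumes "1 \<le> m"
  shows "((\<lambda>k. 1 / (2 * real k - 1) ^ (2 * m)) has_sum mtv [2 * m]) {1..}"
proof -
  have "decr_indices 1 = (\<lambda>k. [k]) ` {1..}"
    by (auto simp: decr_indices_def length_Suc_conv)
  moreover have "(monomial_at odd_inv_sq [m] has_sum mtv [2 * m]) (decr_indices 1)"
    using truncated_sum_limit(1)[OF odd_inv_sq_nonneg odd_inv_sq_le_1 sum_odd_inv_sq_le, of "[m]"]
      assms mtv_map_double[of "[m]"] by simp
  ultimately have "(monomial_at odd_inv_sq [m] \<circ> (\<lambda>k. [k]) has_sum mtv [2 * m]) {1..}"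
    by (simp add: has_sum_reindex inj_on_def)
  moreover have "monomial_at odd_inv_sq [m] \<circ> (\<lambda>k. [k]) = (\<lambda>k. 1 / (2 * real k - 1) ^ (2 * m))"
    by (auto simp: monomial_at_def odd_inv_sq_def power_mult power_divide)
  ultimately show ?thesis by simp
qed

text \<open>The term \<open>k = 1\<close> alone gives 1. This serves to show that the Bernoulli
  numbers in the denominators are nonzero.\<close>

lemma mtv_single_ge_1: "1 \<le> m \<Longrightarrow> 1 \<le> mtv [2 * m]"
  using has_sum_mono2[OF has_sum_finite[of "{1}"] has_sum_mtv_single[of m]]
  by (auto simp: power_mult)

text \<open>Splitting the zeta sum by parity: the even integers contribute
  \<open>1 / 2 ^ (2 * m)\<close> of the whole, the odd ones the t-value.\<close>

lemma mtv_zeta: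
  assumes "1 \<le> m"
  shows "complex_of_real (mtv [2 * m]) = (2 ^ (2 * m) - 1) / 2 ^ (2 * m) * zeta (of_nat (2 * m))"
proof -
  define f where "f = (\<lambda>k. 1 / real k ^ (2 * m))"
  define Z where "Z = (\<Sum>k. f (Suc k))"
  have sm: "summable (\<lambda>k. f (Suc k))"
    using inverse_power_summable[of "2 * m", where ?'a = real] assms
    by (subst summable_Suc_iff) (simp add: f_def inverse_eq_divide)
  then have "((\<lambda>k. f (Suc k)) has_sum Z) UNIV"
    unfolding Z_def by (intro sums_nonneg_imp_has_sum summable_sums) (simp_all add: f_def)
  then have "(f has_sum Z) (Suc ` UNIV)"
    by (simp add: has_sum_reindex o_def)
  moreover have "Suc ` UNIV = {1..}"
    by (auto simp: image_iff intro: Suc_le_D)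
  ultimately have all: "(f has_sum Z) {1..}" by simp
  have "((\<lambda>k. 1 / 2 ^ (2 * m) * f k) has_sum (1 / 2 ^ (2 * m) * Z)) {1..}"
    by (rule has_sum_cmult_right[OF all])
  moreover have "(\<lambda>k. 1 / 2 ^ (2 * m) * f k) = f \<circ> (\<lambda>k. 2 * k)"
    by (auto simp: f_def power_mult_distrib)
  ultimately have even: "(f has_sum (1 / 2 ^ (2 * m) * Z)) ((\<lambda>k. 2 * k) ` {1..})"
    by (simp add: has_sum_reindex inj_on_def)
  have "((f \<circ> (\<lambda>k. 2 * k - 1)) has_sum mtv [2 * m]) {1..}"
    using has_sum_mtv_single[OF assms]
    by (rule has_sum_cong[THEN iffD1, rotated]) (simp add: f_def of_nat_diff)
  then have odd: "(f has_sum mtv [2 * m]) ((\<lambda>k. 2 * k - 1) ` {1..})"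
    by (subst has_sum_reindex) (auto simp: inj_on_def)
  have "(\<lambda>k. 2 * k - 1) ` {1..} \<inter> (\<lambda>k :: nat. 2 * k) ` {1..} = {}"
    by (auto, presburger)
  from has_sum_Un_disjoint[OF odd even this]
  have "(f has_sum (mtv [2 * m] + 1 / 2 ^ (2 * m) * Z))
      ((\<lambda>k. 2 * k - 1) ` {1..} \<union> (\<lambda>k. 2 * k) ` {1..})" .
  also have "(\<lambda>k. 2 * k - 1) ` {1..} \<union> (\<lambda>k. 2 * k) ` {1..} = {1 :: nat..}"
  proof (intro equalityI subsetI)
    fix k :: nat assume k: "k \<in> {1..}"
    show "k \<in> (\<lambda>k. 2 * k - 1) ` {1..} \<union> (\<lambda>k. 2 * k) ` {1..}"
    proof (cases "even k")
      case True
      then show ?thesis using k by (auto elim!: evenE)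
    next
      case False
      then obtain i where "k = 2 * Suc i - 1" by (auto elim!: oddE)
      then show ?thesis by (intro UnI1 image_eqI[of _ _ "Suc i"]) auto
    qed
  qed auto
  finally have "mtv [2 * m] + 1 / 2 ^ (2 * m) * Z = Z"
    using all has_sum_unique by blast
  then have real: "mtv [2 * m] = (2 ^ (2 * m) - 1) / 2 ^ (2 * m) * Z"
    by (simp add: field_simps)
  have "of_nat (Suc k) powr (- of_nat (2 * m)) = complex_of_real (f (Suc k))" for k
  proof -
    have "of_nat (Suc k) powr (- of_nat (2 * m)) = inverse ((of_nat (Suc k) :: complex) ^ (2 * m))"
      by (simp add: powr_minus powr_nat' del: of_nat_Suc of_nat_mult)
    then show ?thesis by (simp add: f_def inverse_eq_divide)
  qed
  then have "zeta (of_nat (2 * m)) = (\<Sum>k. complex_of_real (f (Suc k)))"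
    unfolding zeta_def by simp
  also have "\<dots> = complex_of_real Z"
    unfolding Z_def by (rule suminf_of_real[OF sm, symmetric])
  finally show ?thesis by (simp add: real)
qed

section \<open>Even t-values through Bernoulli numbers\<close>

definition fps_bernoulli :: "real fps" where
  "fps_bernoulli = fps_X / (fps_exp 1 - 1)"

lemma fps_bernoulli_mult: "fps_bernoulli * (fps_exp 1 - 1) = fps_X"
proof -
  have *: "(fps_exp 1 - 1 :: real fps) $ 1 \<noteq> 0" by simp
  then have "fps_exp 1 - 1 \<noteq> (0 :: real fps)" by auto
  moreover have "subdegree (fps_exp 1 - 1 :: real fps) \<le> 1"
    by (rule subdegree_leI[OF *])
  ultimately have "fps_exp 1 - 1 dvd (fps_X :: real fps)"
    by (simp add: fps_dvd_iff)
  then show ?thesis by (simp add: fps_bernoulli_def)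
qed

lemma fps_bernoulli_scaled:
  fixes c :: real
  assumes "c \<noteq> 0"
  shows "(fps_bernoulli oo (fps_const c * fps_X)) * (fps_exp c - 1) = fps_const c * fps_X"
proof -
  have "(fps_bernoulli * (fps_exp 1 - 1)) oo (fps_const c * fps_X) = fps_const c * fps_X"
    by (simp add: fps_bernoulli_mult fps_X_fps_compose_startby0)
  then show ?thesis by (simp add: fps_compose_mult_distrib fps_compose_sub_distrib)
qed

text \<open>
  The case \<open>d = 1\<close> of \<open>fps_cos_sqrt_mult_T_even\<close>, with signs and powers of \<open>pi\<close> removed, says that
  \<open>K\<close> below is \<open>x * tanh x / 2\<close>, which is compared with
  \<open>x * tanh x = \<beta> (4 * x) - \<beta> (2 * x) + x\<close>, where \<open>\<beta> x = x / (exp x - 1)\<close>.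
\<close>
lemma mtv_bernoulli:
  assumes "1 \<le> n"
  shows "mtv [2 * n] = (-1) ^ (n + 1) * pi ^ (2 * n) * (2 ^ (2 * n) - 1) * bernoulli (2 * n) / (2 * fact (2 * n))"
proof -
  let ?c = "pi\<^sup>2 / 4"
  \<comment> \<open>These are the coefficients of \<open>- fps_T_even 1\<close> after substituting
    \<open>- X / ?c\<close> for \<open>X\<close>, which turns the cosine into a hyperbolic one.
    Below, \<open>C oo fps_X ^ 2\<close> is \<open>cosh x\<close> and \<open>S oo fps_X ^ 2\<close>
    is \<open>x * sinh x / 2\<close>.\<close>
  define \<alpha> where "\<alpha> = (\<lambda>k. (-1) ^ (k + 1) * T_even k 1 / ?c ^ k)"
  define C where "C = Abs_fps (\<lambda>m. 1 / fact (2 * m) :: real)"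
  define S where "S = Abs_fps (\<lambda>m. real m / fact (2 * m))"
  define K where "K = Abs_fps \<alpha> oo fps_X ^ 2"
  let ?e = "fps_exp :: real \<Rightarrow> real fps"
  have "C * Abs_fps \<alpha> = S"
  proof (rule fps_ext)
    fix k
    have "(fps_cos_sqrt * fps_T_even 1) $ k = (-1) ^ (k + 1) * real k * T_even k k"
      unfolding fps_cos_sqrt_mult_T_even by simp
    then have *: "(\<Sum>i=0..k. (-1) ^ i * T_even i i * T_even (k - i) 1) = (-1) ^ (k + 1) * real k * T_even k k"
      by (simp only: fps_mult_nth fps_cos_sqrt_def fps_T_even_def fps_nth_Abs_fps)
    have "(C * Abs_fps \<alpha>) $ k = (\<Sum>i=0..k. 1 / fact (2 * i) * \<alpha> (k - i))"
      by (simp add: fps_mult_nth C_def)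
    also have "\<dots> = (\<Sum>i=0..k. (-1) ^ (k + 1) / ?c ^ k * ((-1) ^ i * T_even i i * T_even (k - i) 1))"
    proof (rule sum.cong[OF refl])
      fix i assume "i \<in> {0..k}"
      then obtain l where l: "k = i + l" using le_Suc_ex by auto
      show "1 / fact (2 * i) * \<alpha> (k - i) =
          (-1) ^ (k + 1) / ?c ^ k * ((-1) ^ i * T_even i i * T_even (k - i) 1)"
        unfolding T_even_diag \<alpha>_def by (cases "even i") (simp_all add: l power_add)
    qed
    also have "\<dots> = (-1) ^ (k + 1) / ?c ^ k * ((-1) ^ (k + 1) * real k * T_even k k)"
      unfolding * sum_distrib_left[symmetric] ..
    also have "\<dots> = S $ k"
      by (simp add: S_def T_even_diag flip: power_mult_distrib)
    finally show "(C * Abs_fps \<alpha>) $ k = S $ k" .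
  qed
  then have CK: "(C oo fps_X ^ 2) * K = S oo fps_X ^ 2"
    unfolding K_def by (simp flip: fps_compose_mult_distrib)
  have cosh: "?e 1 + ?e (-1) = fps_const 2 * (C oo fps_X ^ 2)"
    by (rule fps_ext) (auto simp: fps_nth_compose_X_power C_def elim!: evenE)
  have sinh: "fps_X * (?e 1 - ?e (-1)) = fps_const 4 * (S oo fps_X ^ 2)"
  proof (rule fps_ext)
    fix k
    show "(fps_X * (?e 1 - ?e (-1))) $ k = (fps_const 4 * (S oo fps_X ^ 2)) $ k"
    proof (cases "even k")
      case True
      then obtain i where i: "k = 2 * i" by (elim evenE)
      show ?thesis
      proof (cases i)
        case 0
        then show ?thesis by (simp add: i fps_nth_compose_X_power S_def)
      next
        case (Suc l)
        have "fact (2 * Suc l) = (2 * real l + 2) * fact (2 * l + 1)"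
          by (simp add: algebra_simps)
        then show ?thesis
          by (simp add: i Suc fps_nth_compose_X_power S_def add_nonneg_eq_0_iff del: fact_Suc)
            (simp add: divide_simps add_nonneg_eq_0_iff)
      qed
    qed (auto simp: fps_nth_compose_X_power elim!: oddE)
  qed
  have "fps_const 4 = fps_const 2 * fps_const (2 :: real)" by simp
  then have eq: "(?e 1 + ?e (-1)) * (fps_const 2 * K) = fps_X * (?e 1 - ?e (-1))"
    unfolding cosh sinh CK[symmetric] by (simp only: mult_ac)
  \<comment> \<open>Multiplying by \<open>exp x\<close> removes the negative exponent, leaving only
    \<open>exp (2 * x)\<close>.\<close>
  have exps: "?e 1 * (?e 1 + ?e (-1)) = ?e 2 + 1" "?e 1 * (?e 1 - ?e (-1)) = ?e 2 - 1"
    by (simp_all add: distrib_left right_diff_distrib flip: fps_exp_add_mult)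
  have "(?e 2 + 1) * (fps_const 2 * K) = ?e 1 * ((?e 1 + ?e (-1)) * (fps_const 2 * K))"
    unfolding exps(1)[symmetric] by (rule mult.assoc)
  also have "\<dots> = fps_X * (?e 2 - 1)"
    unfolding eq exps(2)[symmetric] by (rule mult.left_commute)
  finally have K: "(?e 2 + 1) * (fps_const 2 * K) = fps_X * (?e 2 - 1)" .
  define B2 where "B2 = fps_bernoulli oo (fps_const 2 * fps_X)"
  define B4 where "B4 = fps_bernoulli oo (fps_const 4 * fps_X)"
  have B2: "B2 * (?e 2 - 1) = fps_const 2 * fps_X" and B4: "B4 * (?e 4 - 1) = fps_const 4 * fps_X"
    unfolding B2_def B4_def by (rule fps_bernoulli_scaled; simp)+
  have "?e 2 * ?e 2 = ?e 4" by (simp flip: fps_exp_add_mult)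
  then have e4: "?e 4 - 1 = (?e 2 + 1) * (?e 2 - 1)" by (simp add: algebra_simps)
  \<comment> \<open>The formula for \<open>x * tanh x\<close> is checked after multiplication by
    \<open>exp (4 * x) - 1\<close>, whose two factors are then cancelled as nonzero series.\<close>
  have "(?e 2 - 1) * ((?e 2 + 1) * (B4 - B2 + fps_X)) =
      B4 * (?e 4 - 1) - (?e 2 + 1) * (B2 * (?e 2 - 1)) + (?e 2 - 1) * ((?e 2 + 1) * fps_X)"
    unfolding e4 by (simp add: algebra_simps)
  also have "\<dots> = (?e 2 - 1) * (fps_X * (?e 2 - 1))"
  proof -
    have *: "fps_const 4 = (4 :: real fps)" "fps_const 2 = (2 :: real fps)"
      by (simp_all add: numeral_fps_const)
    show ?thesis unfolding B2 B4 * by (simp add: algebra_simps)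
  qed
  finally have "(?e 2 - 1) * ((?e 2 + 1) * (B4 - B2 + fps_X)) = (?e 2 - 1) * ((?e 2 + 1) * (fps_const 2 * K))"
    unfolding K .
  moreover have "(?e 2 - 1) $ 1 \<noteq> 0" "(?e 2 + 1) $ 0 \<noteq> 0" by simp_all
  then have "?e 2 - 1 \<noteq> 0" "?e 2 + 1 \<noteq> 0" by force+
  ultimately have "B4 - B2 + fps_X = fps_const 2 * K" by simp
  then have "(B4 - B2 + fps_X) $ (2 * n) = (fps_const 2 * K) $ (2 * n)" by simp
  then have "(4 ^ (2 * n) - 2 ^ (2 * n)) * fps_bernoulli $ (2 * n) = 2 * \<alpha> n"
    unfolding B2_def B4_def K_def by (simp add: fps_nth_compose_X_power left_diff_distrib)
  then have "2 * \<alpha> n = (4 ^ (2 * n) - 2 ^ (2 * n)) * (bernoulli (2 * n) / fact (2 * n))"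
    by (simp add: bernoulli_def fps_bernoulli_def)
  moreover have "(4 :: real) ^ (2 * n) - 2 ^ (2 * n) = 4 ^ n * (2 ^ (2 * n) - 1)"
    by (simp add: power_mult right_diff_distrib flip: power_mult_distrib)
  ultimately have "\<alpha> n = 4 ^ n * (2 ^ (2 * n) - 1) * bernoulli (2 * n) / (2 * fact (2 * n))"
    by simp
  moreover have "mtv [2 * n] = (-1) ^ (n + 1) * ?c ^ n * \<alpha> n"
    unfolding \<alpha>_def T_even_1[OF assms] by (cases "even n") simp_all
  moreover have "?c ^ n * 4 ^ n = pi ^ (2 * n)"
    by (simp add: power_mult flip: power_mult_distrib)
  ultimately show ?thesis by (simp add: mult_ac)
qed

theorem theorem1p1:
  fixes n d :: nat
  assumes "1 \<le> d" and "d \<le> n"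
  shows
    "T_even n d =
       (\<Sum>j=0..(d - 1) div 2.
          (-1) ^ j * pi ^ (2 * j) / (2 ^ (2 * d - 2) * fact (2 * j) * real d)
          * real ((2 * d - 2 * j - 2) choose (d - 1)) * mtv [2 * n - 2 * j])
     \<and> T_even n d =
       real ((2 * d - 2) choose (d - 1)) * (mtv [2 * n] / (2 ^ (2 * d - 2) * real d))
       - (\<Sum>j=1..(d - 1) div 2.
            real ((2 * d - 2 * j - 2) choose (d - 1))
            * (mtv [2 * j] * mtv [2 * n - 2 * j]
               / (2 ^ (2 * d - 3) * (2 ^ (2 * j) - 1) * bernoulli (2 * j) * real d)))
     \<and> (\<forall>m::nat. 1 \<le> m \<longrightarrow>
          ((\<lambda>k::nat. 1 / (2 * real k - 1) ^ (2 * m)) has_sum mtv [2 * m]) {1..}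
          \<and> complex_of_real (mtv [2 * m]) =
              (2 ^ (2 * m) - 1) / 2 ^ (2 * m) * zeta (of_nat (2 * m)))"
proof (intro conjI allI impI)
  let ?u = "\<lambda>j. (-1) ^ j * pi ^ (2 * j) / (2 ^ (2 * d - 2) * fact (2 * j) * real d)
          * real ((2 * d - 2 * j - 2) choose (d - 1)) * mtv [2 * n - 2 * j]"
  let ?v = "\<lambda>j. real ((2 * d - 2 * j - 2) choose (d - 1))
            * (mtv [2 * j] * mtv [2 * n - 2 * j]
               / (2 ^ (2 * d - 3) * (2 ^ (2 * j) - 1) * bernoulli (2 * j) * real d))"
  have u0: "?u 0 = real ((2 * d - 2) choose (d - 1)) * (mtv [2 * n] / (2 ^ (2 * d - 2) * real d))"
  proof -
    have "1 * 1 / (a * 1 * b) * c * t = c * (t / (a * b))" for a b c t :: real by simp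
    then show ?thesis by (simp only: mult_0_right minus_nat.diff_0 power_0 fact_0)
  qed
  show "T_even n d = (\<Sum>j=0..(d - 1) div 2. ?u j)"
    by (rule T_even_formula[OF assms])
  also have "\<dots> = ?u 0 + (\<Sum>j=1..(d - 1) div 2. ?u j)"
    using sum.atLeast_Suc_atMost[of 0 "(d - 1) div 2" ?u] by (simp only: One_nat_def le0)
  \<comment> \<open>\<open>mtv_bernoulli\<close> gives
    \<open>(-1) ^ j * pi ^ (2 * j) / fact (2 * j)\<close> as -2 times \<open>mtv [2 * j]\<close>
    over \<open>(2 ^ (2 * j) - 1) * bernoulli (2 * j)\<close>. The 2 lowers the exponent
    \<open>2 * d - 2\<close> to \<open>2 * d - 3\<close>.\<close>
  also have "(\<Sum>j=1..(d - 1) div 2. ?u j) = (\<Sum>j=1..(d - 1) div 2. - ?v j)"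
  proof (rule sum.cong[OF refl])
    fix j assume "j \<in> {1..(d - 1) div 2}"
    \<comment> \<open>A nonempty range forces \<open>d \<ge> 3\<close>, so the subtractions are
      exact.\<close>
    then have j: "1 \<le> j" "2 * d - 2 = Suc (2 * d - 3)" by auto
    define p where "p = (2 :: real) ^ (2 * j) - 1"
    have "(1 :: real) < 2 ^ (2 * j)" using j(1) by (intro one_less_power) auto
    then have p: "p \<noteq> 0" by (simp add: p_def)
    have t: "mtv [2 * j] = (-1) ^ (j + 1) * pi ^ (2 * j) * p * bernoulli (2 * j) / (2 * fact (2 * j))"
      unfolding p_def by (rule mtv_bernoulli[OF j(1)])
    then have b: "bernoulli (2 * j) \<noteq> 0" using mtv_single_ge_1[OF j(1)] by auto
    show "?u j = - ?v j"
      unfolding t p_def[symmetric] j(2) using p b assms by (simp add: divide_simps)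
  qed
  finally show "T_even n d = real ((2 * d - 2) choose (d - 1)) * (mtv [2 * n] / (2 ^ (2 * d - 2) * real d))
       - (\<Sum>j=1..(d - 1) div 2. ?v j)"
    by (simp only: sum_negf u0 diff_conv_add_uminus)
next
  fix m :: nat assume "1 \<le> m"
  then show "((\<lambda>k::nat. 1 / (2 * real k - 1) ^ (2 * m)) has_sum mtv [2 * m]) {1..}"
    and "complex_of_real (mtv [2 * m]) = (2 ^ (2 * m) - 1) / 2 ^ (2 * m) * zeta (of_nat (2 * m))"
    by (rule has_sum_mtv_single, rule mtv_zeta)
qed

end
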